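(* Let $h\in L^1(\mathbb{R}^n)$ and let $F:\mathbb{R}^n\times X\to Y$ be a continuous function such that for each $B\in\mathcal{B}$ there exists a finite real number $\epsilon_B>0$ with $\sup_{\mathbf{t}\in\mathbb{R}^n,\,x\in B^{\cdot}}\|F(\mathbf{t};x)\|_Y<+\infty$, where $B^{\cdot}:=B^{\circ}\cup\bigcup_{y\in\partial B}B(y,\epsilon_B)$. Then the function $$(h\ast F)(\mathbf{t};x):=\int_{\mathbb{R}^n}h(\sigma)F(\mathbf{t}-\sigma;x)\,d\sigma,\qquad \mathbf{t}\in\mathbb{R}^n,\ x\in X,$$ is well defined and for each $B\in\mathcal{B}$ we have $\sup_{\mathbf{t}\in\mathbb{R}^n,\,x\in B^{\cdot}}\|(h\ast F)(\mathbf{t};x)\|_Y<+\infty$. Furthermore: (i) If $\omega\in\mathbb{R}^n\setminus\{0\}$, $c\in\mathbb{C}\setminus\{0\}$ and $F$ is $(S,\mathbb{R}^n,\mathcal{B})$-asymptotically $(\omega,c)$-periodic, then $h\ast F$ is $(S,\mathbb{R}^n,\mathcal{B})$-asymptotically $(\omega,c)$-periodic. (ii) If $\omega_j\in\mathbb{R}\setminus\{0\}$, $c_j\in\mathbb{C}\setminus\{0\}$ ($1\le j\le n$) and $F$ is $(S,\mathcal{B})$-asymptotically $(\omega_j,c_j,\mathbb{R}^n)_{j\in\mathbb{N}_n}$-periodic, then $h\ast F$ is $(S,\mathcal{B})$-asymptotically $(\omega_j,c_j,\mathbb{R}^n)_{j\in\mathbb{N}_n}$-periodic.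
   Context: $X,Y$ are complex Banach spaces; $\mathbb{N}_n=\{1,\dots,n\}$; $(e_1,\dots,e_n)$ is the standard basis of $\mathbb{R}^n$. $\mathcal{B}$ is a collection of non-empty subsets of $X$ such that every $x\in X$ belongs to some $B\in\mathcal{B}$. $B^\circ$ and $\partial B$ are the interior and boundary of $B$ in $X$, and $B(y,\epsilon)$ is the closed ball in $X$ with center $y$ and radius $\epsilon$. A continuous $G:\mathbb{R}^n\times X\to Y$ is $(S,\mathbb{R}^n,\mathcal{B})$-asymptotically $(\omega,c)$-periodic if for each $B\in\mathcal{B}$: $\lim_{|\mathbf{t}|\to+\infty}\|G(\mathbf{t}+\omega;x)-cG(\mathbf{t};x)\|_Y=0$ uniformly in $x\in B$. It is $(S,\mathcal{B})$-asymptotically $(\omega_j,c_j,\mathbb{R}^n)_{j\in\mathbb{N}_n}$-periodic if for each $B\in\mathcal{B}$ and $j\in\mathbb{N}_n$: $\lim_{|\mathbf{t}|\to+\infty}\|G(\mathbf{t}+\omega_je_j;x)-c_jG(\mathbf{t};x)\|_Y=0$ uniformly in $x\in B$. *)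

theory Defs
  imports "HOL-Analysis.Analysis"
begin

section \<open>Complex Banach spaces\<close>

text \<open>
  The type class of complex Banach spaces: a (real) Banach space whose scalar multiplication is
  extended to the complex numbers, with absolutely homogeneous norm.
\<close>

class complex_banach = banach +
  fixes scaleC :: "complex \<Rightarrow> 'a \<Rightarrow> 'a"  (infixr "*\<^sub>C" 75)
  assumes scaleC_add_right: "a *\<^sub>C (x + y) = a *\<^sub>C x + a *\<^sub>C y"
    and scaleC_add_left: "(a + b) *\<^sub>C x = a *\<^sub>C x + b *\<^sub>C x"
    and scaleC_scaleC: "a *\<^sub>C b *\<^sub>C x = (a * b) *\<^sub>C x"
    and scaleC_of_real: "complex_of_real r *\<^sub>C x = r *\<^sub>R x"
    and norm_scaleC: "norm (a *\<^sub>C x) = cmod a * norm x"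

instantiation complex :: complex_banach
begin

definition scaleC_complex :: "complex \<Rightarrow> complex \<Rightarrow> complex"
  where "scaleC_complex a x = a * x"

instance
  by standard (auto simp: scaleC_complex_def algebra_simps norm_mult scaleR_conv_of_real)

end


section \<open>The Bochner integral in arbitrary Banach spaces\<close>

text \<open>
  The library's \<^const>\<open>has_bochner_integral\<close> requires a second countable codomain.  For a
  general Banach space, Borel measurability of the integrand has to be replaced by strong
  measurability (being an almost everywhere limit of simple functions); the rest of the
  definition is unchanged.
\<close>

definition strongly_measurable :: "'a measure \<Rightarrow> ('a \<Rightarrow> 'b::real_normed_vector) \<Rightarrow> bool" where
  "strongly_measurable M f \<longleftrightarrow>
     (\<exists>s. (\<forall>i. simple_function M (s i)) \<and> (AE x in M. (\<lambda>i::nat. s i x) \<longlonglongrightarrow> f x))"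

definition has_strong_bochner_integral ::
    "'a measure \<Rightarrow> ('a \<Rightarrow> 'b::real_normed_vector) \<Rightarrow> 'b \<Rightarrow> bool" where
  "has_strong_bochner_integral M f I \<longleftrightarrow>
     strongly_measurable M f \<and>
     (\<exists>s. (\<forall>i::nat. Bochner_Integration.simple_bochner_integrable M (s i)) \<and>
          (\<lambda>i. \<integral>\<^sup>+x. norm (f x - s i x) \<partial>M) \<longlonglongrightarrow> 0 \<and>
          (\<lambda>i. Bochner_Integration.simple_bochner_integral M (s i)) \<longlonglongrightarrow> I)"

definition strong_bochner_integrable ::
    "'a measure \<Rightarrow> ('a \<Rightarrow> 'b::real_normed_vector) \<Rightarrow> bool" where
  "strong_bochner_integrable M f \<longleftrightarrow> (\<exists>I. has_strong_bochner_integral M f I)"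

definition strong_bochner_integral ::
    "'a measure \<Rightarrow> ('a \<Rightarrow> 'b::real_normed_vector) \<Rightarrow> 'b" where
  "strong_bochner_integral M f = (THE I. has_strong_bochner_integral M f I)"

lemma has_strong_bochner_integral_unique:
  assumes "has_strong_bochner_integral M f I" "has_strong_bochner_integral M f J"
  shows "I = J"
proof -
  obtain u where u: "\<And>i. simple_function M (u i)" and uf: "AE x in M. (\<lambda>i::nat. u i x) \<longlonglongrightarrow> f x"
    using assms(1) unfolding has_strong_bochner_integral_def strongly_measurable_def by blast
  obtain s where s: "\<And>i. Bochner_Integration.simple_bochner_integrable M (s i)"
    and s0: "(\<lambda>i. \<integral>\<^sup>+x. norm (f x - s i x) \<partial>M) \<longlonglongrightarrow> 0"
    and sI: "(\<lambda>i::nat. Bochner_Integration.simple_bochner_integral M (s i)) \<longlonglongrightarrow> I"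
    using assms(1) unfolding has_strong_bochner_integral_def by blast
  obtain t where t: "\<And>i. Bochner_Integration.simple_bochner_integrable M (t i)"
    and t0: "(\<lambda>i. \<integral>\<^sup>+x. norm (f x - t i x) \<partial>M) \<longlonglongrightarrow> 0"
    and tJ: "(\<lambda>i::nat. Bochner_Integration.simple_bochner_integral M (t i)) \<longlonglongrightarrow> J"
    using assms(2) unfolding has_strong_bochner_integral_def by blast
  define N where "N v x = liminf (\<lambda>k. ennreal (norm (u k x - v x)))" for v x
  have sf: "simple_function M v" if "Bochner_Integration.simple_bochner_integrable M v" for v :: "'a \<Rightarrow> 'b"
    using that by (auto elim: simple_bochner_integrable.cases)
  have Nm: "N v \<in> borel_measurable M" if "Bochner_Integration.simple_bochner_integrable M v" for v
  proof -
    have "simple_function M (\<lambda>x. ennreal (norm (u k x - v x)))" for k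
      using simple_function_compose2[OF u[of k] sf[OF that], of "\<lambda>a b. ennreal (norm (a - b))"] .
    then have "(\<lambda>x. ennreal (norm (u k x - v x))) \<in> borel_measurable M" for k
      by (rule borel_measurable_simple_function)
    then show ?thesis
      unfolding N_def by measurable
  qed
  have N_AE: "AE x in M. ennreal (norm (f x - v x)) = N v x" for v
    using uf
  proof eventually_elim
    case (elim x)
    then have "(\<lambda>k. ennreal (norm (u k x - v x))) \<longlonglongrightarrow> ennreal (norm (f x - v x))"
      by (intro tendsto_intros)
    then show ?case
      unfolding N_def by (intro lim_imp_Liminf[symmetric]) simp_all
  qed
  then have N_int: "(\<integral>\<^sup>+x. norm (f x - v x) \<partial>M) = (\<integral>\<^sup>+x. N v x \<partial>M)" for v
    by (rule nn_integral_cong_AE)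
  have bound: "ennreal (norm (Bochner_Integration.simple_bochner_integral M (s i) - Bochner_Integration.simple_bochner_integral M (t i)))
      \<le> (\<integral>\<^sup>+x. norm (f x - s i x) \<partial>M) + (\<integral>\<^sup>+x. norm (f x - t i x) \<partial>M)" for i
  proof -
    have st: "Bochner_Integration.simple_bochner_integrable M (\<lambda>x. s i x - t i x)"
      using simple_bochner_integrable_compose2[of "(-)" M "s i" "t i"] s t by auto
    have nst: "Bochner_Integration.simple_bochner_integrable M (\<lambda>x. norm (s i x - t i x))"
      using simple_bochner_integrable_compose2[of "\<lambda>x y. norm (x - y)" M "s i" "t i"] s t by auto
    have "ennreal (norm (Bochner_Integration.simple_bochner_integral M (s i) - Bochner_Integration.simple_bochner_integral M (t i)))
        = norm (Bochner_Integration.simple_bochner_integral M (\<lambda>x. s i x - t i x))"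
      using s t by (subst simple_bochner_integral_diff) auto
    also have "\<dots> \<le> Bochner_Integration.simple_bochner_integral M (\<lambda>x. norm (s i x - t i x))"
      using st by (auto intro!: simple_bochner_integral_norm_bound ennreal_leI)
    also have "\<dots> = (\<integral>\<^sup>+x. norm (s i x - t i x) \<partial>M)"
      using nst by (auto intro!: simple_bochner_integral_eq_nn_integral)
    also have "\<dots> \<le> (\<integral>\<^sup>+x. N (s i) x + N (t i) x \<partial>M)"
    proof (rule nn_integral_mono_AE)
      show "AE x in M. ennreal (norm (s i x - t i x)) \<le> N (s i) x + N (t i) x"
        using N_AE[of "s i"] N_AE[of "t i"]
      proof eventually_elim
        case (elim x)
        have "norm (s i x - t i x) \<le> norm (f x - s i x) + norm (f x - t i x)"
          by (metis dual_order.refl norm_diff_triangle_le norm_minus_commute)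
        then have "ennreal (norm (s i x - t i x))
            \<le> ennreal (norm (f x - s i x)) + ennreal (norm (f x - t i x))"
          by (metis ennreal_leI ennreal_plus norm_ge_zero)
        then show ?case using elim by simp
      qed
    qed
    also have "\<dots> = (\<integral>\<^sup>+x. N (s i) x \<partial>M) + (\<integral>\<^sup>+x. N (t i) x \<partial>M)"
      using s t by (intro nn_integral_add Nm)
    finally show ?thesis by (simp add: N_int)
  qed
  have "(\<lambda>i. ennreal (norm (Bochner_Integration.simple_bochner_integral M (s i) - Bochner_Integration.simple_bochner_integral M (t i))))
      \<longlonglongrightarrow> ennreal (norm (I - J))"
    by (intro tendsto_intros sI tJ)
  moreover have "(\<lambda>i. ennreal (norm (Bochner_Integration.simple_bochner_integral M (s i) - Bochner_Integration.simple_bochner_integral M (t i))))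
      \<longlonglongrightarrow> 0"
    by (rule tendsto_sandwich[OF _ _ tendsto_const, where h = "\<lambda>i. (\<integral>\<^sup>+x. norm (f x - s i x) \<partial>M)
          + (\<integral>\<^sup>+x. norm (f x - t i x) \<partial>M)"])
       (use bound tendsto_add[OF s0 t0] in auto)
  ultimately have "ennreal (norm (I - J)) = 0"
    by (rule LIMSEQ_unique)
  then show ?thesis by simp
qed

lemma has_bochner_integral_imp_strong:
  fixes f :: "'a \<Rightarrow> 'b::{banach, second_countable_topology}"
  assumes "has_bochner_integral M f I"
  shows "has_strong_bochner_integral M f I"
  using assms
proof cases
  case (1 s)
  obtain u where "\<And>i. simple_function M (u i)" "\<And>x. x \<in> space M \<Longrightarrow> (\<lambda>i. u i x) \<longlonglongrightarrow> f x"
    using borel_measurable_implies_sequence_metric[OF 1(1), of 0] by blast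
  then have "strongly_measurable M f"
    unfolding strongly_measurable_def by (intro exI[of _ u]) (auto intro: AE_I2)
  with 1 show ?thesis
    unfolding has_strong_bochner_integral_def by blast
qed


section \<open>Convolution and asymptotic periodicity\<close>

definition convolution ::
    "(real^'n \<Rightarrow> complex) \<Rightarrow> (real^'n \<Rightarrow> 'x \<Rightarrow> 'y::complex_banach) \<Rightarrow> real^'n \<Rightarrow> 'x \<Rightarrow> 'y" where
  "convolution h F t x = strong_bochner_integral lebesgue (\<lambda>\<sigma>. h \<sigma> *\<^sub>C F (t - \<sigma>) x)"

definition dot_enlargement :: "real \<Rightarrow> 'x::metric_space set \<Rightarrow> 'x set" where
  "dot_enlargement \<epsilon> B = interior B \<union> (\<Union>y\<in>frontier B. cball y \<epsilon>)"

text \<open>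
  \<^const>\<open>at_infinity\<close> is the filter \<open>\<bar>t\<bar> \<longrightarrow> \<infinity>\<close>.  Joint continuity of the function is part of both
  notions of asymptotic periodicity.
\<close>

definition S_asymptotically_periodic ::
    "'x set set \<Rightarrow> real^'n \<Rightarrow> complex \<Rightarrow> (real^'n \<Rightarrow> 'x::complex_banach \<Rightarrow> 'y::complex_banach) \<Rightarrow> bool"
where
  "S_asymptotically_periodic \<B> \<omega> c G \<longleftrightarrow>
     continuous_on UNIV (\<lambda>(t, x). G t x) \<and>
     (\<forall>B\<in>\<B>. uniform_limit B (\<lambda>t x. norm (G (t + \<omega>) x - c *\<^sub>C G t x)) (\<lambda>_. 0) at_infinity)"

definition S_asymptotically_periodic_coordwise ::
    "'x set set \<Rightarrow> ('n \<Rightarrow> real) \<Rightarrow> ('n \<Rightarrow> complex) \<Rightarrow>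
      (real^'n \<Rightarrow> 'x::complex_banach \<Rightarrow> 'y::complex_banach) \<Rightarrow> bool"
where
  "S_asymptotically_periodic_coordwise \<B> \<omega> c G \<longleftrightarrow>
     continuous_on UNIV (\<lambda>(t, x). G t x) \<and>
     (\<forall>B\<in>\<B>. \<forall>j. uniform_limit B
        (\<lambda>t x. norm (G (t + \<omega> j *\<^sub>R axis j 1) x - c j *\<^sub>C G t x)) (\<lambda>_. 0) at_infinity)"

end

theory Submission
  imports Defs
begin

text \<open>
  No separability of \<open>Y\<close> is needed: the integrand is a continuous function of the point
  \<open>(h \<sigma>, \<sigma>)\<close> of the separable space \<open>\<complex> \<times> \<real>\<^sup>n\<close>, hence strongly measurable, and it is
  dominated by a multiple of \<open>\<bar>h\<bar>\<close>.  Every \<open>x \<in> B\<close> is interior to the enlargement of \<open>B\<close>, so \<open>F\<close> is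
  bounded uniformly near \<open>x\<close> and dominated convergence makes the convolution continuous.  By
  linearity its \<open>(\<omega>, c)\<close>-difference is the convolution of \<open>h\<close> with the \<open>(\<omega>, c)\<close>-difference of
  \<open>F\<close>, which is bounded on \<open>B\<close> and uniformly small away from a ball, while the mass of \<open>h\<close> on
  that ball translated by \<open>t\<close> vanishes as \<open>t \<longrightarrow> \<infinity>\<close>.
\<close>

section \<open>Complex scalar multiplication as a bounded bilinear map\<close>

lemma bounded_bilinear_scaleC:
  "bounded_bilinear (scaleC :: complex \<Rightarrow> 'a \<Rightarrow> 'a::complex_banach)"
proof
  fix a a' :: complex and b b' :: 'a and r :: real
  have r: "r *\<^sub>R b = complex_of_real r *\<^sub>C b" for r and b :: 'a
    by (simp add: scaleC_of_real)
  show "(a + a') *\<^sub>C b = a *\<^sub>C b + a' *\<^sub>C b" by (rule scaleC_add_left)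
  show "a *\<^sub>C (b + b') = a *\<^sub>C b + a *\<^sub>C b'" by (rule scaleC_add_right)
  show "(r *\<^sub>R a) *\<^sub>C b = r *\<^sub>R (a *\<^sub>C b)"
    unfolding r by (simp add: scaleC_scaleC scaleR_conv_of_real)
  show "a *\<^sub>C (r *\<^sub>R b) = r *\<^sub>R (a *\<^sub>C b)"
    unfolding r by (simp add: scaleC_scaleC mult.commute)
  show "\<exists>K. \<forall>a (b::'a). norm (a *\<^sub>C b) \<le> norm a * norm b * K"
    by (rule exI[of _ 1]) (simp add: norm_scaleC)
qed

lemmas bounded_linear_scaleC_right = bounded_bilinear.bounded_linear_right[OF bounded_bilinear_scaleC]
lemmas continuous_on_scaleC = bounded_bilinear.continuous_on[OF bounded_bilinear_scaleC]
lemmas scaleC_diff_right = bounded_bilinear.diff_right[OF bounded_bilinear_scaleC]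

section \<open>The strong Bochner integral\<close>

text \<open>Second countability makes the measurable \<open>f\<close> a pointwise limit of simple
  functions, and composing with the continuous \<open>g\<close> preserves both simplicity and
  convergence. Separability is thus asked of the intermediate space only; the codomain of
  \<open>g\<close> may be nonseparable.\<close>

lemma strongly_measurable_compose_continuous:
  fixes f :: "'a \<Rightarrow> 'b::{metric_space, second_countable_topology}"
  assumes "f \<in> borel_measurable M" "continuous_on UNIV g"
  shows "strongly_measurable M (\<lambda>x. g (f x))"
proof -
  obtain u where u: "\<And>i. simple_function M (u i)"
    and lim: "\<And>x. x \<in> space M \<Longrightarrow> (\<lambda>i. u i x) \<longlonglongrightarrow> f x"
    \<comment> \<open>Any base point serves: it only anchors a distance bound on the
      approximants.\<close>
    using borel_measurable_implies_sequence_metric[OF assms(1), of undefined] by blast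
  have "(\<lambda>i. g (u i x)) \<longlonglongrightarrow> g (f x)" if "x \<in> space M" for x
    using continuous_on_tendsto_compose[OF assms(2) lim[OF that]] by simp
  with u show ?thesis
    unfolding strongly_measurable_def
    by (intro exI[of _ "\<lambda>i x. g (u i x)"]) (auto intro: simple_function_compose1)
qed

section \<open>Closure properties of strong measurability\<close>

lemma strongly_measurable_simple_function:
  "simple_function M f \<Longrightarrow> strongly_measurable M f"
  unfolding strongly_measurable_def by (intro exI[of _ "\<lambda>_. f"]) auto

lemma strongly_measurable_diff:
  assumes "strongly_measurable M f" "strongly_measurable M g"
  shows "strongly_measurable M (\<lambda>x. f x - g x)"
proof -
  obtain u v where u: "\<And>i. simple_function M (u i)" "AE x in M. (\<lambda>i::nat. u i x) \<longlonglongrightarrow> f x"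
    and v: "\<And>i. simple_function M (v i)" "AE x in M. (\<lambda>i::nat. v i x) \<longlonglongrightarrow> g x"
    using assms unfolding strongly_measurable_def by blast
  have "AE x in M. (\<lambda>i. u i x - v i x) \<longlonglongrightarrow> f x - g x"
    using u(2) v(2) by eventually_elim (rule tendsto_diff)
  with u(1) v(1) show ?thesis
    unfolding strongly_measurable_def by (intro exI[of _ "\<lambda>i x. u i x - v i x"]) auto
qed

lemma strongly_measurable_bounded_linear:
  assumes "bounded_linear T" "strongly_measurable M f"
  shows "strongly_measurable M (\<lambda>x. T (f x))"
proof -
  obtain u where u: "\<And>i. simple_function M (u i)" "AE x in M. (\<lambda>i::nat. u i x) \<longlonglongrightarrow> f x"
    using assms(2) unfolding strongly_measurable_def by blast
  have "AE x in M. (\<lambda>i. T (u i x)) \<longlonglongrightarrow> T (f x)"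
    using u(2) by eventually_elim (rule bounded_linear.tendsto[OF assms(1)])
  with u(1) show ?thesis
    unfolding strongly_measurable_def
    by (intro exI[of _ "\<lambda>i x. T (u i x)"]) (auto intro: simple_function_compose1)
qed

text \<open>Strong measurability determines \<open>norm (f x)\<close> only up to a null set. The
  measurable version \<open>N\<close> is what additivity, scaling and dominated convergence of the
  nonnegative integral are applied to.\<close>

lemma strongly_measurable_norm:
  assumes "strongly_measurable M f"
  obtains N :: "'a \<Rightarrow> real" where "N \<in> borel_measurable M" "AE x in M. norm (f x) = N x"
proof -
  obtain u where u: "\<And>i. simple_function M (u i)" "AE x in M. (\<lambda>i::nat. u i x) \<longlonglongrightarrow> f x"
    using assms unfolding strongly_measurable_def by blast
  have [measurable]: "(\<lambda>x. norm (u i x)) \<in> borel_measurable M" for i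
    by (intro borel_measurable_simple_function simple_function_compose1[OF u(1)])
  \<comment> \<open>\<open>lim\<close> is total, so the right-hand side is measurable everywhere,
    including points where the norms diverge.\<close>
  have "AE x in M. norm (f x) = lim (\<lambda>i. norm (u i x))"
    using u(2) by eventually_elim (rule limI[symmetric], rule tendsto_norm)
  then show thesis
    by (intro that[of "\<lambda>x. lim (\<lambda>i. norm (u i x))"]) measurable
qed

text \<open>Monotonicity of the nonnegative integral holds for an arbitrary \<open>k\<close>, but
  additivity asks for measurable summands, so the two norms are first replaced by measurable
  versions.\<close>

lemma nn_integral_norm_le_add:
  assumes "strongly_measurable M f" "strongly_measurable M g"
    and "\<And>x. norm (k x) \<le> norm (f x) + norm (g x)"
  shows "(\<integral>\<^sup>+x. norm (k x) \<partial>M) \<le> (\<integral>\<^sup>+x. norm (f x) \<partial>M) + (\<integral>\<^sup>+x. norm (g x) \<partial>M)"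
proof -
  obtain P where P[measurable]: "P \<in> borel_measurable M" "AE x in M. norm (f x) = P x"
    using strongly_measurable_norm[OF assms(1)] by blast
  obtain Q where Q[measurable]: "Q \<in> borel_measurable M" "AE x in M. norm (g x) = Q x"
    using strongly_measurable_norm[OF assms(2)] by blast
  have "(\<integral>\<^sup>+x. norm (k x) \<partial>M) \<le> (\<integral>\<^sup>+x. ennreal (P x) + ennreal (Q x) \<partial>M)"
  proof (rule nn_integral_mono_AE)
    show "AE x in M. ennreal (norm (k x)) \<le> ennreal (P x) + ennreal (Q x)"
      using P(2) Q(2)
    proof eventually_elim
      case (elim x)
      then show ?case
        using assms(3)[of x] by (metis ennreal_leI ennreal_plus norm_ge_zero)
    qed
  qed
  also have "\<dots> = (\<integral>\<^sup>+x. P x \<partial>M) + (\<integral>\<^sup>+x. Q x \<partial>M)"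
    by (rule nn_integral_add) measurable
  also have "(\<integral>\<^sup>+x. P x \<partial>M) = (\<integral>\<^sup>+x. norm (f x) \<partial>M)"
    using P(2) by (intro nn_integral_cong_AE) auto
  also have "(\<integral>\<^sup>+x. Q x \<partial>M) = (\<integral>\<^sup>+x. norm (g x) \<partial>M)"
    using Q(2) by (intro nn_integral_cong_AE) auto
  finally show ?thesis .
qed

lemma nn_integral_norm_le_cmult:
  assumes "strongly_measurable M f" "0 \<le> C" "\<And>x. norm (k x) \<le> C * norm (f x)"
  shows "(\<integral>\<^sup>+x. norm (k x) \<partial>M) \<le> ennreal C * (\<integral>\<^sup>+x. norm (f x) \<partial>M)"
proof -
  obtain P where P[measurable]: "P \<in> borel_measurable M" "AE x in M. norm (f x) = P x"
    using strongly_measurable_norm[OF assms(1)] by blast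
  have "(\<integral>\<^sup>+x. norm (k x) \<partial>M) \<le> (\<integral>\<^sup>+x. ennreal C * ennreal (P x) \<partial>M)"
  proof (rule nn_integral_mono_AE)
    show "AE x in M. ennreal (norm (k x)) \<le> ennreal C * ennreal (P x)"
      using P(2)
    proof eventually_elim
      case (elim x)
      then show ?case
        using assms(2) assms(3)[of x] by (metis ennreal_leI ennreal_mult norm_ge_zero)
    qed
  qed
  also have "\<dots> = ennreal C * (\<integral>\<^sup>+x. P x \<partial>M)"
    by (rule nn_integral_cmult) measurable
  also have "(\<integral>\<^sup>+x. P x \<partial>M) = (\<integral>\<^sup>+x. norm (f x) \<partial>M)"
    using P(2) by (intro nn_integral_cong_AE) auto
  finally show ?thesis .
qed

lemma norm_simple_bochner_integral_le:
  assumes "Bochner_Integration.simple_bochner_integrable M s"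
  shows "ennreal (norm (Bochner_Integration.simple_bochner_integral M s)) \<le> (\<integral>\<^sup>+x. norm (s x) \<partial>M)"
proof -
  have "Bochner_Integration.simple_bochner_integrable M (\<lambda>x. norm (s x))"
    \<comment> \<open>The rule for two functions, fed a map that ignores its second argument, yields
      composition with a single function.\<close>
    using simple_bochner_integrable_compose2[of "\<lambda>x y. norm x" M s s] assms by auto
  then show ?thesis
    using simple_bochner_integral_norm_bound[OF assms]
    by (metis ennreal_leI norm_ge_zero simple_bochner_integral_eq_nn_integral)
qed

lemma simple_function_simple_bochner_integrable:
  "Bochner_Integration.simple_bochner_integrable M f \<Longrightarrow> simple_function M f"
  by (erule simple_bochner_integrable.cases)

text \<open>The estimate holds for the approximating simple functions. The triangle inequality
  replaces their norms by that of \<open>f\<close> plus an error tending to 0, and the inequality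
  survives the limit.\<close>

lemma norm_has_strong_bochner_integral_le:
  assumes "has_strong_bochner_integral M f I"
  shows "ennreal (norm I) \<le> (\<integral>\<^sup>+x. norm (f x) \<partial>M)"
proof -
  obtain s where f: "strongly_measurable M f"
    and s: "\<And>i. Bochner_Integration.simple_bochner_integrable M (s i)"
    and s0: "(\<lambda>i. \<integral>\<^sup>+x. norm (f x - s i x) \<partial>M) \<longlonglongrightarrow> 0"
    and sI: "(\<lambda>i::nat. Bochner_Integration.simple_bochner_integral M (s i)) \<longlonglongrightarrow> I"
    using assms unfolding has_strong_bochner_integral_def by blast
  show ?thesis
  proof (rule LIMSEQ_le)
    show "(\<lambda>i. ennreal (norm (Bochner_Integration.simple_bochner_integral M (s i)))) \<longlonglongrightarrow> ennreal (norm I)"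
      by (intro tendsto_intros sI)
    show "(\<lambda>i. (\<integral>\<^sup>+x. norm (f x - s i x) \<partial>M) + (\<integral>\<^sup>+x. norm (f x) \<partial>M)) \<longlonglongrightarrow> (\<integral>\<^sup>+x. norm (f x) \<partial>M)"
      using tendsto_add[OF s0 tendsto_const[of "\<integral>\<^sup>+x. norm (f x) \<partial>M"]] by simp
    have "ennreal (norm (Bochner_Integration.simple_bochner_integral M (s i)))
        \<le> (\<integral>\<^sup>+x. norm (f x - s i x) \<partial>M) + (\<integral>\<^sup>+x. norm (f x) \<partial>M)" for i
    proof -
      have "(\<integral>\<^sup>+x. norm (s i x) \<partial>M) \<le> (\<integral>\<^sup>+x. norm (f x - s i x) \<partial>M) + (\<integral>\<^sup>+x. norm (f x) \<partial>M)"
      proof (rule nn_integral_norm_le_add)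
        show "strongly_measurable M (\<lambda>x. f x - s i x)"
          by (intro strongly_measurable_diff f strongly_measurable_simple_function
              simple_function_simple_bochner_integrable s)
        show "norm (s i x) \<le> norm (f x - s i x) + norm (f x)" for x
          by (metis add.commute norm_minus_commute norm_triangle_sub)
      qed (rule f)
      with norm_simple_bochner_integral_le[OF s] show ?thesis
        by (rule order_trans)
    qed
    then show "\<exists>N. \<forall>i\<ge>N. ennreal (norm (Bochner_Integration.simple_bochner_integral M (s i)))
        \<le> (\<integral>\<^sup>+x. norm (f x - s i x) \<partial>M) + (\<integral>\<^sup>+x. norm (f x) \<partial>M)"
      by blast
  qed
qed

section \<open>Linearity of the strong Bochner integral\<close>

lemma has_strong_bochner_integral_bounded_linear:
  assumes T: "bounded_linear T" and "has_strong_bochner_integral M f I"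
  shows "has_strong_bochner_integral M (\<lambda>x. T (f x)) (T I)"
proof -
  interpret T: bounded_linear T by fact
  obtain s where f: "strongly_measurable M f"
    and s: "\<And>i. Bochner_Integration.simple_bochner_integrable M (s i)"
    and s0: "(\<lambda>i. \<integral>\<^sup>+x. norm (f x - s i x) \<partial>M) \<longlonglongrightarrow> 0"
    and sI: "(\<lambda>i::nat. Bochner_Integration.simple_bochner_integral M (s i)) \<longlonglongrightarrow> I"
    using assms(2) unfolding has_strong_bochner_integral_def by blast
  obtain K where K: "0 \<le> K" "\<And>x. norm (T x) \<le> K * norm x"
    using T.nonneg_bounded by (auto simp: mult.commute)
  have Ts: "Bochner_Integration.simple_bochner_integrable M (\<lambda>x. T (s i x))" for i
    \<comment> \<open>\<open>T 0 = 0\<close> keeps the support of the composed simple function of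
      finite measure.\<close>
    using simple_bochner_integrable_compose2[of "\<lambda>x y. T x" M "s i" "s i"] s by (auto simp: T.zero)
  have fs: "strongly_measurable M (\<lambda>x. f x - s i x)" for i
    by (intro strongly_measurable_diff f strongly_measurable_simple_function
        simple_function_simple_bochner_integrable s)
  have "(\<lambda>i. \<integral>\<^sup>+x. norm (T (f x) - T (s i x)) \<partial>M) \<longlonglongrightarrow> 0"
  proof (rule tendsto_sandwich[OF _ _ tendsto_const])
    show "(\<lambda>i. ennreal K * (\<integral>\<^sup>+x. norm (f x - s i x) \<partial>M)) \<longlonglongrightarrow> 0"
      using ennreal_tendsto_cmult[OF _ s0, of "ennreal K"] by simp
    have "(\<integral>\<^sup>+x. norm (T (f x) - T (s i x)) \<partial>M) \<le> ennreal K * (\<integral>\<^sup>+x. norm (f x - s i x) \<partial>M)" for i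
      by (rule nn_integral_norm_le_cmult[OF fs K(1)]) (metis K(2) T.diff)
    then show "\<forall>\<^sub>F i in sequentially. (\<integral>\<^sup>+x. norm (T (f x) - T (s i x)) \<partial>M)
        \<le> ennreal K * (\<integral>\<^sup>+x. norm (f x - s i x) \<partial>M)"
      by simp
  qed simp
  moreover have "(\<lambda>i. Bochner_Integration.simple_bochner_integral M (\<lambda>x. T (s i x))) \<longlonglongrightarrow> T I"
    using T.tendsto[OF sI] by (simp add: simple_bochner_integral_linear[OF T.linear_axioms s])
  ultimately show ?thesis
    unfolding has_strong_bochner_integral_def
    using Ts strongly_measurable_bounded_linear[OF T f]
    by (intro conjI exI[of _ "\<lambda>i x. T (s i x)"] allI)
qed

lemma has_strong_bochner_integral_diff:
  assumes "has_strong_bochner_integral M f I" "has_strong_bochner_integral M g J"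
  shows "has_strong_bochner_integral M (\<lambda>x. f x - g x) (I - J)"
proof -
  obtain s where f: "strongly_measurable M f"
    and s: "\<And>i. Bochner_Integration.simple_bochner_integrable M (s i)"
    and s0: "(\<lambda>i. \<integral>\<^sup>+x. norm (f x - s i x) \<partial>M) \<longlonglongrightarrow> 0"
    and sI: "(\<lambda>i::nat. Bochner_Integration.simple_bochner_integral M (s i)) \<longlonglongrightarrow> I"
    using assms(1) unfolding has_strong_bochner_integral_def by blast
  obtain t where g: "strongly_measurable M g"
    and t: "\<And>i. Bochner_Integration.simple_bochner_integrable M (t i)"
    and t0: "(\<lambda>i. \<integral>\<^sup>+x. norm (g x - t i x) \<partial>M) \<longlonglongrightarrow> 0"
    and tJ: "(\<lambda>i::nat. Bochner_Integration.simple_bochner_integral M (t i)) \<longlonglongrightarrow> J"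
    using assms(2) unfolding has_strong_bochner_integral_def by blast
  have st: "Bochner_Integration.simple_bochner_integrable M (\<lambda>x. s i x - t i x)" for i
    using simple_bochner_integrable_compose2[of "(-)" M "s i" "t i"] s t by auto
  have "(\<lambda>i. \<integral>\<^sup>+x. norm ((f x - g x) - (s i x - t i x)) \<partial>M) \<longlonglongrightarrow> 0"
  proof (rule tendsto_sandwich[OF _ _ tendsto_const])
    show "(\<lambda>i. (\<integral>\<^sup>+x. norm (f x - s i x) \<partial>M) + (\<integral>\<^sup>+x. norm (g x - t i x) \<partial>M)) \<longlonglongrightarrow> 0"
      using tendsto_add[OF s0 t0] by simp
    have "(\<integral>\<^sup>+x. norm ((f x - g x) - (s i x - t i x)) \<partial>M)
        \<le> (\<integral>\<^sup>+x. norm (f x - s i x) \<partial>M) + (\<integral>\<^sup>+x. norm (g x - t i x) \<partial>M)" for i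
    proof (rule nn_integral_norm_le_add)
      show "norm ((f x - g x) - (s i x - t i x)) \<le> norm (f x - s i x) + norm (g x - t i x)" for x
        using norm_triangle_ineq4[of "f x - s i x" "g x - t i x"] by (simp add: algebra_simps)
    qed (intro strongly_measurable_diff f g strongly_measurable_simple_function
        simple_function_simple_bochner_integrable s t)+
    then show "\<forall>\<^sub>F i in sequentially. (\<integral>\<^sup>+x. norm ((f x - g x) - (s i x - t i x)) \<partial>M)
        \<le> (\<integral>\<^sup>+x. norm (f x - s i x) \<partial>M) + (\<integral>\<^sup>+x. norm (g x - t i x) \<partial>M)"
      by simp
  qed simp
  moreover have "(\<lambda>i. Bochner_Integration.simple_bochner_integral M (\<lambda>x. s i x - t i x)) \<longlonglongrightarrow> I - J"
    using tendsto_diff[OF sI tJ] by (simp add: simple_bochner_integral_diff s t)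
  ultimately show ?thesis
    unfolding has_strong_bochner_integral_def
    using st strongly_measurable_diff[OF f g]
    by (intro conjI exI[of _ "\<lambda>i x. s i x - t i x"] allI)
qed

section \<open>The value of the integral and a criterion for its existence\<close>

lemma strong_bochner_integral_eqI:
  assumes "has_strong_bochner_integral M f I"
  shows "strong_bochner_integral M f = I"
  unfolding strong_bochner_integral_def
  using assms by (rule the_equality) (rule has_strong_bochner_integral_unique[OF _ assms])

lemma strong_bochner_integralI:
  assumes "strong_bochner_integrable M f"
  shows "has_strong_bochner_integral M f (strong_bochner_integral M f)"
  using assms strong_bochner_integral_eqI unfolding strong_bochner_integrable_def by fastforce

text \<open>
  Truncating the approximating simple functions where their norm exceeds twice that of the limit
  makes dominated convergence applicable to them.
\<close>

lemma strong_bochner_integrableI_bounded: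
  fixes f :: "'a \<Rightarrow> 'b::banach"
  assumes f: "strongly_measurable M f" and fin: "(\<integral>\<^sup>+x. norm (f x) \<partial>M) < \<infinity>"
  shows "strong_bochner_integrable M f"
proof -
  obtain u where u: "\<And>i. simple_function M (u i)" and uf: "AE x in M. (\<lambda>i::nat. u i x) \<longlonglongrightarrow> f x"
    using f unfolding strongly_measurable_def by blast
  obtain N where N[measurable]: "N \<in> borel_measurable M" and fN: "AE x in M. norm (f x) = N x"
    using strongly_measurable_norm[OF f] by blast
  define s where "s i x = (if norm (u i x) \<le> 2 * N x then u i x else 0)" for i x
  have [measurable]: "(\<lambda>x. norm (u i x)) \<in> borel_measurable M" for i
    by (intro borel_measurable_simple_function simple_function_compose1[OF u])
  have s: "simple_function M (s i)" for i
    unfolding s_def by (intro simple_function_If u) (simp_all, measurable)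
  have sf: "AE x in M. (\<lambda>i. s i x) \<longlonglongrightarrow> f x"
    using uf fN
  proof eventually_elim
    case (elim x)
    show ?case
    \<comment> \<open>At a zero of \<open>f\<close> the threshold is 0 and forces
      \<open>s i x = 0\<close>. Elsewhere \<open>norm (f x)\<close> lies strictly below the
      threshold, so the truncation is eventually inactive.\<close>
    proof (cases "f x = 0")
      case True
      then have "s i x = 0" for i using elim by (simp add: s_def)
      then show ?thesis using True by simp
    next
      case False
      then have "norm (f x) < 2 * N x" using elim(2)[symmetric] by simp
      then have "\<forall>\<^sub>F i in sequentially. norm (u i x) < 2 * N x"
        by (rule order_tendstoD[OF tendsto_norm[OF elim(1)]])
      then have "\<forall>\<^sub>F i in sequentially. u i x = s i x"
        by eventually_elim (simp add: s_def)
      then show ?thesis using elim(1) by (rule Lim_transform_eventually[rotated])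
    qed
  qed
  have "(\<integral>\<^sup>+x. norm (f x) \<partial>M) = (\<integral>\<^sup>+x. N x \<partial>M)"
    using fN by (intro nn_integral_cong_AE) auto
  with fin have N_fin: "(\<integral>\<^sup>+x. N x \<partial>M) < \<infinity>"
    by simp
  \<comment> \<open>\<open>N\<close> is known to be nonnegative only where it agrees with
    \<open>norm (f x)\<close>, so the branch with value 0 satisfies the bound merely almost
    everywhere.\<close>
  have s_le: "AE x in M. norm (s i x) \<le> 2 * N x" for i
    using fN
  proof eventually_elim
    case (elim x)
    have "0 \<le> N x" using elim norm_ge_zero[of "f x"] by linarith
    then show ?case by (simp add: s_def)
  qed
  have N2_fin: "(\<integral>\<^sup>+x. ennreal (C * N x) \<partial>M) < \<infinity>" if "0 \<le> C" for C
  proof -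
    have "(\<integral>\<^sup>+x. ennreal (C * N x) \<partial>M) = ennreal C * (\<integral>\<^sup>+x. N x \<partial>M)"
      by (simp add: ennreal_mult' that nn_integral_cmult)
    then show ?thesis using N_fin by (simp add: ennreal_mult_less_top)
  qed
  have si: "Bochner_Integration.simple_bochner_integrable M (s i)" for i
  proof (rule simple_bochner_integrableI_bounded[OF s])
    have "(\<integral>\<^sup>+x. norm (s i x) \<partial>M) \<le> (\<integral>\<^sup>+x. ennreal (2 * N x) \<partial>M)"
      using s_le[of i] by (intro nn_integral_mono_AE) (auto intro: ennreal_leI)
    then show "(\<integral>\<^sup>+x. norm (s i x) \<partial>M) < \<infinity>"
      using N2_fin[of 2] by (simp add: le_less_trans)
  qed
  have fs: "strongly_measurable M (\<lambda>x. f x - s i x)" for i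
    by (intro strongly_measurable_diff f strongly_measurable_simple_function s)
  \<comment> \<open>Dominated convergence asks for measurable integrands, so each error norm gets a
    measurable version \<open>D i\<close>. As there are countably many indices, a single null set
    handles all of them.\<close>
  have "\<exists>D. D \<in> borel_measurable M \<and> (AE x in M. norm (f x - s i x) = D x)" for i
    using strongly_measurable_norm[OF fs[of i]] by metis
  then obtain D :: "nat \<Rightarrow> 'a \<Rightarrow> real"
    where D: "\<And>i. D i \<in> borel_measurable M" "\<And>i. AE x in M. norm (f x - s i x) = D i x"
    by metis
  note D(1)[measurable]
  have AE_D: "AE x in M. \<forall>i. norm (f x - s i x) = D i x"
    unfolding AE_all_countable using D(2) by blast
  \<comment> \<open>The factor 3 in the majorant is 1 for \<open>f\<close> plus 2 for the truncated
    approximants.\<close>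
  have "(\<lambda>i. \<integral>\<^sup>+x. D i x \<partial>M) \<longlonglongrightarrow> (\<integral>\<^sup>+x. 0 \<partial>M)"
  proof (rule nn_integral_dominated_convergence[where w = "\<lambda>x. ennreal (3 * N x)"])
    show "(\<integral>\<^sup>+x. ennreal (3 * N x) \<partial>M) < \<infinity>"
      by (rule N2_fin) simp
    show "AE x in M. ennreal (D i x) \<le> ennreal (3 * N x)" for i
      using AE_D fN s_le[of i]
    proof eventually_elim
      case (elim x)
      then have "D i x = norm (f x - s i x)" by simp
      then have "D i x \<le> norm (f x) + norm (s i x)" by (metis norm_triangle_ineq4)
      with elim show ?case by (intro ennreal_leI) simp
    qed
    show "AE x in M. (\<lambda>i. ennreal (D i x)) \<longlonglongrightarrow> 0"
      using AE_D sf
    proof eventually_elim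
      case (elim x)
      have "(\<lambda>i. ennreal (norm (f x - s i x))) \<longlonglongrightarrow> ennreal (norm (f x - f x))"
        by (intro tendsto_intros elim)
      with elim show ?case by simp
    qed
  qed measurable
  moreover have "(\<integral>\<^sup>+x. D i x \<partial>M) = (\<integral>\<^sup>+x. norm (f x - s i x) \<partial>M)" for i
    using D(2)[of i] by (intro nn_integral_cong_AE) auto
  ultimately have s0: "(\<lambda>i. \<integral>\<^sup>+x. norm (f x - s i x) \<partial>M) \<longlonglongrightarrow> 0"
    by simp
  let ?J = "\<lambda>i. Bochner_Integration.simple_bochner_integral M (s i)"
  have J_diff: "ennreal (norm (?J m - ?J n))
      \<le> (\<integral>\<^sup>+x. norm (f x - s m x) \<partial>M) + (\<integral>\<^sup>+x. norm (f x - s n x) \<partial>M)" for m n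
  proof -
    have mn: "Bochner_Integration.simple_bochner_integrable M (\<lambda>x. s m x - s n x)"
      using simple_bochner_integrable_compose2[of "(-)" M "s m" "s n"] si by auto
    have "ennreal (norm (?J m - ?J n)) \<le> (\<integral>\<^sup>+x. norm (s m x - s n x) \<partial>M)"
      using norm_simple_bochner_integral_le[OF mn] by (simp add: simple_bochner_integral_diff si)
    also have "\<dots> \<le> (\<integral>\<^sup>+x. norm (f x - s m x) \<partial>M) + (\<integral>\<^sup>+x. norm (f x - s n x) \<partial>M)"
    proof (rule nn_integral_norm_le_add[OF fs fs])
      show "norm (s m x - s n x) \<le> norm (f x - s m x) + norm (f x - s n x)" for x
        by (metis dual_order.refl norm_diff_triangle_le norm_minus_commute)
    qed
    finally show ?thesis .
  qed
  \<comment> \<open>The candidate value of the integral comes from completeness of the target space: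
    two simple integrals differ by at most the sum of their approximation errors.\<close>
  have "Cauchy ?J"
  proof (rule metric_CauchyI)
    fix e :: real assume e: "0 < e"
    then have "\<forall>\<^sub>F i in sequentially. (\<integral>\<^sup>+x. norm (f x - s i x) \<partial>M) < ennreal (e / 2)"
      using order_tendstoD(2)[OF s0, of "ennreal (e / 2)"] by simp
    then obtain K where K: "\<And>i. i \<ge> K \<Longrightarrow> (\<integral>\<^sup>+x. norm (f x - s i x) \<partial>M) < ennreal (e / 2)"
      unfolding eventually_sequentially by blast
    show "\<exists>K. \<forall>m\<ge>K. \<forall>n\<ge>K. dist (?J m) (?J n) < e"
    proof (intro exI allI impI)
      fix m n assume "K \<le> m" "K \<le> n"
      then have "ennreal (norm (?J m - ?J n)) < ennreal (e / 2) + ennreal (e / 2)"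
        by (intro le_less_trans[OF J_diff] add_strict_mono K)
      also have "\<dots> = ennreal e"
        using e by (simp flip: ennreal_plus)
      finally show "dist (?J m) (?J n) < e"
        using e by (simp add: dist_norm ennreal_less_iff)
    qed
  qed
  then obtain I where "?J \<longlonglongrightarrow> I"
    using Cauchy_convergent convergent_def by blast
  then show ?thesis
    unfolding strong_bochner_integrable_def has_strong_bochner_integral_def
    using f si s0 by blast
qed

section \<open>Integrating a bounded continuous function against an integrable density\<close>

lemma integrable_norm_mult_bounded:
  fixes h :: "'a::euclidean_space \<Rightarrow> complex" and k :: "'a \<Rightarrow> 'b::real_normed_vector"
  assumes h: "integrable lebesgue h" and k: "continuous_on UNIV k" and bd: "\<And>\<sigma>. norm (k \<sigma>) \<le> K"
  shows "integrable lebesgue (\<lambda>\<sigma>. norm (h \<sigma>) * norm (k \<sigma>))"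
proof (rule Bochner_Integration.integrable_bound)
  show "integrable lebesgue (\<lambda>\<sigma>. norm (h \<sigma>) * K)"
    using h by simp
  have "(\<lambda>\<sigma>. norm (k \<sigma>)) \<in> borel_measurable borel"
    by (intro borel_measurable_continuous_onI continuous_intros k)
  then have [measurable]: "(\<lambda>\<sigma>. norm (k \<sigma>)) \<in> borel_measurable lebesgue"
    by (simp add: measurable_completion)
  have [measurable]: "h \<in> borel_measurable lebesgue"
    using h by (rule borel_measurable_integrable)
  show "(\<lambda>\<sigma>. norm (h \<sigma>) * norm (k \<sigma>)) \<in> borel_measurable lebesgue"
    by measurable
  show "AE \<sigma> in lebesgue. norm (norm (h \<sigma>) * norm (k \<sigma>)) \<le> norm (norm (h \<sigma>) * K)"
  proof (rule AE_I2)
    fix \<sigma>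
    have "norm (h \<sigma>) * norm (k \<sigma>) \<le> norm (h \<sigma>) * K"
      by (intro mult_left_mono bd) simp
    then show "norm (norm (h \<sigma>) * norm (k \<sigma>)) \<le> norm (norm (h \<sigma>) * K)"
      by simp
  qed
qed

text \<open>Strong measurability is obtained by factoring the integrand through
  \<open>(h \<sigma>, \<sigma>)\<close>. The bound is stated with an ordinary real integral so that
  later estimates can use its monotonicity, linearity and limit theorems.\<close>

lemma
  fixes h :: "'a::euclidean_space \<Rightarrow> complex" and k :: "'a \<Rightarrow> 'b::complex_banach"
  assumes h: "integrable lebesgue h" and k: "continuous_on UNIV k" and bd: "\<And>\<sigma>. norm (k \<sigma>) \<le> K"
  shows strong_bochner_integrable_scaleC:
      "strong_bochner_integrable lebesgue (\<lambda>\<sigma>. h \<sigma> *\<^sub>C k \<sigma>)" (is ?int)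
    and norm_strong_bochner_integral_scaleC_le:
      "norm (strong_bochner_integral lebesgue (\<lambda>\<sigma>. h \<sigma> *\<^sub>C k \<sigma>))
        \<le> (\<integral>\<sigma>. norm (h \<sigma>) * norm (k \<sigma>) \<partial>lebesgue)" (is ?le)
proof -
  have [measurable]: "h \<in> borel_measurable lebesgue"
    using h by (rule borel_measurable_integrable)
  have [measurable]: "(\<lambda>\<sigma>::'a. \<sigma>) \<in> borel_measurable lebesgue"
    by (simp add: measurable_completion)
  have "strongly_measurable lebesgue (\<lambda>\<sigma>. (\<lambda>(a, \<sigma>). a *\<^sub>C k \<sigma>) (h \<sigma>, \<sigma>))"
  proof (rule strongly_measurable_compose_continuous)
    show "(\<lambda>\<sigma>. (h \<sigma>, \<sigma>)) \<in> borel_measurable lebesgue"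
      by (intro borel_measurable_Pair) measurable
    have "continuous_on UNIV (\<lambda>p::complex \<times> 'a. fst p *\<^sub>C k (snd p))"
      by (intro continuous_on_scaleC continuous_on_compose2[OF k] continuous_intros) simp
    then show "continuous_on UNIV (\<lambda>(a, \<sigma>). a *\<^sub>C k \<sigma>)"
      by (simp add: case_prod_unfold)
  qed
  then have sm: "strongly_measurable lebesgue (\<lambda>\<sigma>. h \<sigma> *\<^sub>C k \<sigma>)"
    by simp
  note int = integrable_norm_mult_bounded[OF h k bd]
  \<comment> \<open>Because the norm is exactly multiplicative, one identity yields both the
    finiteness that gives existence and the value of the norm bound.\<close>
  have eq: "(\<integral>\<^sup>+\<sigma>. norm (h \<sigma> *\<^sub>C k \<sigma>) \<partial>lebesgue) = ennreal (\<integral>\<sigma>. norm (h \<sigma>) * norm (k \<sigma>) \<partial>lebesgue)"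
    unfolding norm_scaleC using int by (rule nn_integral_eq_integral) simp
  show ?int
    by (rule strong_bochner_integrableI_bounded[OF sm]) (simp add: eq)
  then have "ennreal (norm (strong_bochner_integral lebesgue (\<lambda>\<sigma>. h \<sigma> *\<^sub>C k \<sigma>)))
      \<le> ennreal (\<integral>\<sigma>. norm (h \<sigma>) * norm (k \<sigma>) \<partial>lebesgue)"
    unfolding eq[symmetric] by (rule norm_has_strong_bochner_integral_le[OF strong_bochner_integralI])
  then show ?le
    by (simp add: integral_nonneg_AE)
qed

section \<open>Convolutions\<close>

text \<open>For fixed \<open>t\<close>, the reflected translate \<open>F (t - \<sigma>) x\<close> is
  continuous in \<open>\<sigma>\<close> and obeys the same bound \<open>K\<close>. The resulting
  estimate is independent of \<open>t\<close> and uniform over all \<open>x\<close> sharing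
  \<open>K\<close>.\<close>

lemma
  fixes F :: "real^'n \<Rightarrow> 'x \<Rightarrow> 'y::complex_banach"
  assumes h: "integrable lebesgue h" and F: "continuous_on UNIV (\<lambda>t. F t x)"
    and bd: "\<And>t. norm (F t x) \<le> K"
  shows strong_bochner_integrable_convolution:
      "strong_bochner_integrable lebesgue (\<lambda>\<sigma>. h \<sigma> *\<^sub>C F (t - \<sigma>) x)"
    and norm_convolution_le:
      "norm (convolution h F t x) \<le> (\<integral>\<sigma>. norm (h \<sigma>) \<partial>lebesgue) * K"
proof -
  have F': "continuous_on UNIV (\<lambda>\<sigma>. F (t - \<sigma>) x)"
    by (intro continuous_on_compose2[OF F] continuous_intros) simp
  show "strong_bochner_integrable lebesgue (\<lambda>\<sigma>. h \<sigma> *\<^sub>C F (t - \<sigma>) x)"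
    by (rule strong_bochner_integrable_scaleC[OF h F' bd])
  have "norm (convolution h F t x) \<le> (\<integral>\<sigma>. norm (h \<sigma>) * norm (F (t - \<sigma>) x) \<partial>lebesgue)"
    unfolding convolution_def by (rule norm_strong_bochner_integral_scaleC_le[OF h F' bd])
  also have "\<dots> \<le> (\<integral>\<sigma>. norm (h \<sigma>) * K \<partial>lebesgue)"
    by (rule integral_mono[OF integrable_norm_mult_bounded[OF h F' bd]])
       (use h in \<open>auto intro!: mult_left_mono bd\<close>)
  also have "\<dots> = (\<integral>\<sigma>. norm (h \<sigma>) \<partial>lebesgue) * K"
    by simp
  finally show "norm (convolution h F t x) \<le> (\<integral>\<sigma>. norm (h \<sigma>) \<partial>lebesgue) * K" .
qed

text \<open>Joint continuity of \<open>F\<close> gives pointwise convergence of the integrands, and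
  the bound on the neighbourhood \<open>U\<close> gives the integrable majorant
  \<open>norm (h \<sigma>) * (2 * K)\<close>, so dominated convergence applies.\<close>

lemma convolution_tendsto:
  fixes F :: "real^'n \<Rightarrow> 'x::metric_space \<Rightarrow> 'y::complex_banach"
  assumes h: "integrable lebesgue h" and F: "continuous_on UNIV (\<lambda>(t, x). F t x)"
    and U: "open U" "x \<in> U" and bd: "\<And>t y. y \<in> U \<Longrightarrow> norm (F t y) \<le> K"
    and T: "T \<longlonglongrightarrow> t" and X: "X \<longlonglongrightarrow> x"
  shows "(\<lambda>n. convolution h F (T n) (X n)) \<longlonglongrightarrow> convolution h F t x"
proof -
  have F': "continuous_on UNIV (\<lambda>\<sigma>. F (t - \<sigma>) y)" for t y
  proof -
    have "continuous_on UNIV (\<lambda>\<sigma>. case (t - \<sigma>, y) of (t, x) \<Rightarrow> F t x)"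
      by (intro continuous_on_compose2[OF F] continuous_intros) simp
    then show ?thesis by simp
  qed
  have hF: "has_strong_bochner_integral lebesgue (\<lambda>\<sigma>. h \<sigma> *\<^sub>C F (t - \<sigma>) y) (convolution h F t y)"
    if "y \<in> U" for t y
    unfolding convolution_def
    by (intro strong_bochner_integralI strong_bochner_integrable_scaleC[OF h F' bd[OF that]])
  have XU: "\<forall>\<^sub>F n in sequentially. X n \<in> U"
    using topological_tendstoD[OF X U] .
  \<comment> \<open>Only eventually does \<open>X n\<close> lie in \<open>U\<close>. Setting
    \<open>d n\<close> to 0 otherwise makes the bound \<open>2 * K\<close> and the continuity of
    \<open>d n\<close> valid for every \<open>n\<close>.\<close>
  define d where "d n \<sigma> = (if X n \<in> U then F (T n - \<sigma>) (X n) - F (t - \<sigma>) x else 0)" for n \<sigma>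
  have d_cont: "continuous_on UNIV (d n)" for n
    unfolding d_def by (cases "X n \<in> U") (auto intro!: continuous_intros F')
  have K: "0 \<le> K"
    using bd[OF U(2), of t] norm_ge_zero order_trans by blast
  have d_bd: "norm (d n \<sigma>) \<le> 2 * K" for n \<sigma>
    using norm_triangle_ineq4[of "F (T n - \<sigma>) (X n)" "F (t - \<sigma>) x"] bd[of "X n" "T n - \<sigma>"]
      bd[OF U(2), of "t - \<sigma>"] K by (auto simp: d_def)
  have d_lim: "(\<lambda>n. d n \<sigma>) \<longlonglongrightarrow> 0" for \<sigma>
  proof -
    have "(\<lambda>n. (T n - \<sigma>, X n)) \<longlonglongrightarrow> (t - \<sigma>, x)"
      by (intro tendsto_intros T X)
    then have "(\<lambda>n. F (T n - \<sigma>) (X n)) \<longlonglongrightarrow> F (t - \<sigma>) x"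
      using continuous_on_tendsto_compose[OF F, of "\<lambda>n. (T n - \<sigma>, X n)" "(t - \<sigma>, x)"] by simp
    then have "(\<lambda>n. F (T n - \<sigma>) (X n) - F (t - \<sigma>) x) \<longlonglongrightarrow> 0"
      by (rule LIM_zero)
    then show ?thesis
      by (rule Lim_transform_eventually) (use XU in eventually_elim, simp add: d_def)
  qed
  note d_int = integrable_norm_mult_bounded[OF h d_cont d_bd]
  have "(\<lambda>n. \<integral>\<sigma>. norm (h \<sigma>) * norm (d n \<sigma>) \<partial>lebesgue) \<longlonglongrightarrow> (\<integral>\<sigma>. 0 \<partial>(lebesgue :: (real^'n) measure))"
  proof (rule integral_dominated_convergence)
    show "integrable lebesgue (\<lambda>\<sigma>. norm (h \<sigma>) * (2 * K))"
      using h by simp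
    show "(\<lambda>\<sigma>. norm (h \<sigma>) * norm (d n \<sigma>)) \<in> borel_measurable lebesgue" for n
      using d_int by (rule borel_measurable_integrable)
    show "AE \<sigma> in lebesgue. (\<lambda>n. norm (h \<sigma>) * norm (d n \<sigma>)) \<longlonglongrightarrow> 0"
      using tendsto_mult_right_zero[OF tendsto_norm_zero[OF d_lim]] by simp
    show "AE \<sigma> in lebesgue. norm (norm (h \<sigma>) * norm (d n \<sigma>)) \<le> norm (h \<sigma>) * (2 * K)" for n
      using d_bd by (auto intro!: mult_left_mono)
  qed simp
  then have lim: "(\<lambda>n. \<integral>\<sigma>. norm (h \<sigma>) * norm (d n \<sigma>) \<partial>lebesgue) \<longlonglongrightarrow> 0"
    by simp
  have "\<forall>\<^sub>F n in sequentially. norm (convolution h F (T n) (X n) - convolution h F t x)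
      \<le> (\<integral>\<sigma>. norm (h \<sigma>) * norm (d n \<sigma>) \<partial>lebesgue)"
    using XU
  proof eventually_elim
    case (elim n)
    \<comment> \<open>With \<open>X n\<close> in \<open>U\<close>, the function \<open>d n\<close>
      is the true difference of the two translates of \<open>F\<close>.\<close>
    have "strong_bochner_integral lebesgue (\<lambda>\<sigma>. h \<sigma> *\<^sub>C d n \<sigma>)
        = convolution h F (T n) (X n) - convolution h F t x"
      using has_strong_bochner_integral_diff[OF hF[OF elim] hF[OF U(2)]] elim
      by (intro strong_bochner_integral_eqI) (simp add: d_def scaleC_diff_right)
    then show ?case
      using norm_strong_bochner_integral_scaleC_le[OF h d_cont d_bd, of n] by simp
  qed
  then have "(\<lambda>n. convolution h F (T n) (X n) - convolution h F t x) \<longlonglongrightarrow> 0"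
    by (rule Lim_null_comparison[OF _ lim])
  then show ?thesis
    by (rule LIM_zero_cancel)
qed

section \<open>Decay at infinity and asymptotic periodicity of the convolution\<close>

text \<open>For fixed \<open>\<sigma>\<close> the integrand is 0 as soon as \<open>r\<close> reaches
  \<open>norm \<sigma>\<close>, and it is dominated by the integrable
  \<open>norm (h \<sigma>)\<close>.\<close>

lemma integrable_tail_tendsto_0:
  fixes h :: "'a::euclidean_space \<Rightarrow> complex"
  assumes h: "integrable lebesgue h"
  shows "((\<lambda>r. \<integral>\<sigma>. norm (h \<sigma>) * indicator {\<sigma>. r < norm \<sigma>} \<sigma> \<partial>lebesgue) \<longlongrightarrow> 0) at_top"
proof -
  have [measurable]: "h \<in> borel_measurable lebesgue"
    using h by (rule borel_measurable_integrable)
  have [measurable]: "{\<sigma>::'a. r < norm \<sigma>} \<in> sets lebesgue" for r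
    by (intro sets_completionI_sets) simp
  have "((\<lambda>r. \<integral>\<sigma>. norm (h \<sigma>) * indicator {\<sigma>. r < norm \<sigma>} \<sigma> \<partial>lebesgue)
      \<longlongrightarrow> (\<integral>\<sigma>. 0 \<partial>(lebesgue :: 'a measure))) at_top"
  proof (rule integral_dominated_convergence_at_top)
    show "integrable lebesgue (\<lambda>\<sigma>. norm (h \<sigma>))"
      using h by simp
    show "\<forall>\<^sub>F r in at_top. AE \<sigma> in lebesgue.
        norm (norm (h \<sigma>) * indicator {\<sigma>. r < norm \<sigma>} \<sigma>) \<le> norm (h \<sigma>)"
      by (auto simp: indicator_def)
    show "AE \<sigma> in lebesgue. ((\<lambda>r. norm (h \<sigma>) * indicator {\<sigma>. r < norm \<sigma>} \<sigma>) \<longlongrightarrow> 0) at_top"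
    proof (rule AE_I2)
      fix \<sigma> :: 'a
      have "\<forall>\<^sub>F r in at_top. norm (h \<sigma>) * indicator {\<sigma>. r < norm \<sigma>} \<sigma> = 0"
        using eventually_ge_at_top[of "norm \<sigma>"] by eventually_elim simp
      then show "((\<lambda>r. norm (h \<sigma>) * indicator {\<sigma>. r < norm \<sigma>} \<sigma>) \<longlongrightarrow> 0) at_top"
        by (rule tendsto_eventually)
    qed
  qed measurable
  then show ?thesis by simp
qed

text \<open>
  Split the integral at \<open>norm (t - \<sigma>) = R\<close>: beyond \<open>R\<close> the difference is uniformly small, and the
  remaining \<open>\<sigma>\<close> satisfy \<open>norm \<sigma> > norm t - R\<close>, so they only see the tail of \<open>h\<close>.
\<close>

lemma convolution_asymptotically_periodic:
  fixes F :: "real^'n \<Rightarrow> 'x \<Rightarrow> 'y::complex_banach"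
  assumes h: "integrable lebesgue h" and F: "\<And>x. x \<in> B \<Longrightarrow> continuous_on UNIV (\<lambda>t. F t x)"
    and bd: "\<And>t x. x \<in> B \<Longrightarrow> norm (F t x) \<le> K"
    and lim: "uniform_limit B (\<lambda>t x. norm (F (t + \<omega>) x - c *\<^sub>C F t x)) (\<lambda>_. 0) at_infinity"
  shows "uniform_limit B (\<lambda>t x. norm (convolution h F (t + \<omega>) x - c *\<^sub>C convolution h F t x))
    (\<lambda>_. 0) at_infinity"
proof (rule uniform_limitI)
  fix e :: real assume e: "0 < e"
  define H where "H = (\<integral>\<sigma>. norm (h \<sigma>) \<partial>lebesgue)"
  \<comment> \<open>\<open>L\<close> will bound the difference \<open>D\<close> on \<open>B\<close>.
    The absolute value makes the bound monotone in the factors without knowing the sign of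
    \<open>K\<close>, and \<open>+ 1\<close> makes \<open>L\<close> a legitimate divisor in the
    threshold \<open>e / (2 * L)\<close>.\<close>
  define L where "L = (1 + norm c) * \<bar>K\<bar> + 1"
  \<comment> \<open>\<open>H + 1\<close> keeps the divisor positive even if \<open>h\<close>
    vanishes almost everywhere, and still gives \<open>H * \<delta> \<le> e / 2\<close>.\<close>
  define \<delta> where "\<delta> = e / (2 * (H + 1))"
  define tail where "tail r = (\<integral>\<sigma>. norm (h \<sigma>) * indicator {\<sigma>. r < norm \<sigma>} \<sigma> \<partial>lebesgue)" for r
  have H: "0 \<le> H" unfolding H_def by simp
  have L: "0 < L" unfolding L_def by (intro add_nonneg_pos mult_nonneg_nonneg) auto
  have \<delta>: "0 < \<delta>" using e H by (simp add: \<delta>_def)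
  define D where "D t x = F (t + \<omega>) x - c *\<^sub>C F t x" for t x
  have D_le: "norm (D t x) \<le> L" if "x \<in> B" for t x
  proof -
    have "norm (D t x) \<le> norm (F (t + \<omega>) x) + norm c * norm (F t x)"
      unfolding D_def norm_scaleC[symmetric] by (rule norm_triangle_ineq4)
    also have "\<dots> \<le> \<bar>K\<bar> + norm c * \<bar>K\<bar>"
      using bd[OF that, of "t + \<omega>"] bd[OF that, of t] by (intro add_mono mult_left_mono) auto
    also have "\<dots> \<le> L" by (simp add: L_def algebra_simps)
    finally show ?thesis .
  qed
  \<comment> \<open>Uniformity of the limit provides one \<open>R\<close> for all \<open>x\<close>
    in \<open>B\<close>, so the threshold for \<open>norm t\<close> found below is also independent
    of \<open>x\<close>.\<close>
  obtain R where R: "\<And>t x. R \<le> norm t \<Longrightarrow> x \<in> B \<Longrightarrow> norm (D t x) < \<delta>"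
    using uniform_limitD[OF lim \<delta>] unfolding eventually_at_infinity D_def by (auto simp: dist_real_def)
  have "((\<lambda>t::real^'n. tail (norm t - R)) \<longlongrightarrow> 0) at_infinity"
  proof (rule filterlim_compose[OF integrable_tail_tendsto_0[OF h, folded tail_def]])
    show "filterlim (\<lambda>t::real^'n. norm t - R) at_top at_infinity"
      using filterlim_tendsto_add_at_top[OF tendsto_const[of "- R"] filterlim_norm_at_top] by simp
  qed
  then have "\<forall>\<^sub>F t::real^'n in at_infinity. tail (norm t - R) < e / (2 * L)"
    by (rule order_tendstoD) (use e L in simp)
  then show "\<forall>\<^sub>F t in at_infinity. \<forall>x\<in>B.
      dist (norm (convolution h F (t + \<omega>) x - c *\<^sub>C convolution h F t x)) 0 < e"
  proof eventually_elim
    case (elim t)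
    show ?case
    proof
      fix x assume x: "x \<in> B"
      have hF: "has_strong_bochner_integral lebesgue (\<lambda>\<sigma>. h \<sigma> *\<^sub>C F (s - \<sigma>) x) (convolution h F s x)" for s
        unfolding convolution_def
        by (intro strong_bochner_integralI
            strong_bochner_integrable_convolution[where F = F and x = x and K = K] h F bd x)
      have F': "continuous_on UNIV (\<lambda>\<sigma>. F (s - \<sigma>) x)" for s
        by (intro continuous_on_compose2[OF F[OF x]] continuous_intros) simp
      have D_cont: "continuous_on UNIV (\<lambda>\<sigma>. D (t - \<sigma>) x)"
      proof -
        have "continuous_on UNIV (\<lambda>\<sigma>. F ((t + \<omega>) - \<sigma>) x - c *\<^sub>C F (t - \<sigma>) x)"
          by (intro continuous_intros continuous_on_scaleC F')
        then show ?thesis by (simp add: D_def algebra_simps)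
      qed
      have "has_strong_bochner_integral lebesgue
          (\<lambda>\<sigma>. h \<sigma> *\<^sub>C F ((t + \<omega>) - \<sigma>) x - c *\<^sub>C h \<sigma> *\<^sub>C F (t - \<sigma>) x)
          (convolution h F (t + \<omega>) x - c *\<^sub>C convolution h F t x)"
        by (intro has_strong_bochner_integral_diff hF
            has_strong_bochner_integral_bounded_linear[OF bounded_linear_scaleC_right])
      \<comment> \<open>Regroup \<open>(t + \<omega>) - \<sigma>\<close> as
        \<open>(t - \<sigma>) + \<omega>\<close> and commute the scalars \<open>c\<close> and
        \<open>h \<sigma>\<close>.\<close>
      also have "(\<lambda>\<sigma>. h \<sigma> *\<^sub>C F ((t + \<omega>) - \<sigma>) x - c *\<^sub>C h \<sigma> *\<^sub>C F (t - \<sigma>) x)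
          = (\<lambda>\<sigma>. h \<sigma> *\<^sub>C D (t - \<sigma>) x)"
        by (simp add: D_def scaleC_diff_right scaleC_scaleC mult.commute algebra_simps)
      finally have "norm (convolution h F (t + \<omega>) x - c *\<^sub>C convolution h F t x)
          = norm (strong_bochner_integral lebesgue (\<lambda>\<sigma>. h \<sigma> *\<^sub>C D (t - \<sigma>) x))"
        using strong_bochner_integral_eqI by metis
      also have "\<dots> \<le> (\<integral>\<sigma>. norm (h \<sigma>) * norm (D (t - \<sigma>) x) \<partial>lebesgue)"
        by (rule norm_strong_bochner_integral_scaleC_le[OF h D_cont D_le[OF x]])
      also have "\<dots> \<le> (\<integral>\<sigma>. norm (h \<sigma>) * \<delta>
          + L * (norm (h \<sigma>) * indicator {\<sigma>. norm t - R < norm \<sigma>} \<sigma>) \<partial>lebesgue)"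
      proof (rule integral_mono[OF integrable_norm_mult_bounded[OF h D_cont D_le[OF x]]])
        have "{\<sigma>::real^'n. norm t - R < norm \<sigma>} \<in> sets lebesgue"
          by (intro sets_completionI_sets) simp
        then show "integrable lebesgue (\<lambda>\<sigma>. norm (h \<sigma>) * \<delta>
            + L * (norm (h \<sigma>) * indicator {\<sigma>. norm t - R < norm \<sigma>} \<sigma>))"
          using h by (intro Bochner_Integration.integrable_add integrable_mult_left
              integrable_mult_right integrable_real_mult_indicator integrable_norm)
        fix \<sigma>
        have "norm (D (t - \<sigma>) x) \<le> \<delta> + L * indicator {\<sigma>. norm t - R < norm \<sigma>} \<sigma>"
        proof (cases "R \<le> norm (t - \<sigma>)")
          case True
          then show ?thesis using R[OF True x] L by (simp add: indicator_def)
        next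
          case False
          then have "norm t - R < norm \<sigma>" using norm_triangle_sub[of t \<sigma>] by linarith
          then show ?thesis using D_le[OF x, of "t - \<sigma>"] \<delta> by simp
        qed
        then have "norm (h \<sigma>) * norm (D (t - \<sigma>) x)
            \<le> norm (h \<sigma>) * (\<delta> + L * indicator {\<sigma>. norm t - R < norm \<sigma>} \<sigma>)"
          by (rule mult_left_mono) simp
        then show "norm (h \<sigma>) * norm (D (t - \<sigma>) x)
            \<le> norm (h \<sigma>) * \<delta> + L * (norm (h \<sigma>) * indicator {\<sigma>. norm t - R < norm \<sigma>} \<sigma>)"
          by (simp add: algebra_simps)
      qed
      also have "\<dots> = H * \<delta> + L * tail (norm t - R)"
      proof -
        have "{\<sigma>::real^'n. norm t - R < norm \<sigma>} \<in> sets lebesgue"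
          by (intro sets_completionI_sets) simp
        then show ?thesis
          unfolding H_def tail_def using h
          by (subst Bochner_Integration.integral_add)
             (auto intro!: integrable_real_mult_indicator)
      qed
      \<comment> \<open>Strictness comes from the tail term; the other half is only a weak
        inequality.\<close>
      also have "\<dots> < e / 2 + e / 2"
      proof (rule add_le_less_mono)
        have "H * \<delta> \<le> (H + 1) * \<delta>" using \<delta> by (intro mult_right_mono) auto
        also have "\<dots> = e / 2" using H by (simp add: \<delta>_def field_simps)
        finally show "H * \<delta> \<le> e / 2" .
        show "L * tail (norm t - R) < e / 2"
          using elim L by (simp add: field_simps)
      qed
      finally show "dist (norm (convolution h F (t + \<omega>) x - c *\<^sub>C convolution h F t x)) 0 < e"
        by simp
    qed
  qed
qed

section \<open>Open neighbourhoods inside the enlargement of a set\<close>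

text \<open>A boundary point is the centre of an open ball inside the enlargement, and the interior
  of \<open>B\<close> is itself open. So a bound on the enlargement holds on a neighbourhood of
  every point of \<open>B\<close>, as the continuity of the convolution requires.\<close>

lemma closure_subset_interior_dot_enlargement:
  assumes "0 < \<epsilon>"
  shows "closure B \<subseteq> interior (dot_enlargement \<epsilon> B)"
proof -
  have "interior B \<subseteq> interior (dot_enlargement \<epsilon> B)"
    by (intro interior_maximal) (auto simp: dot_enlargement_def)
  moreover have "frontier B \<subseteq> interior (dot_enlargement \<epsilon> B)"
  proof
    fix x assume x: "x \<in> frontier B"
    have "ball x \<epsilon> \<subseteq> cball x \<epsilon>"
      by (rule ball_subset_cball)
    also have "\<dots> \<subseteq> dot_enlargement \<epsilon> B"
      unfolding dot_enlargement_def using x by (intro le_supI2 UN_upper)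
    finally have "ball x \<epsilon> \<subseteq> interior (dot_enlargement \<epsilon> B)"
      by (rule interior_maximal[OF _ open_ball])
    then show "x \<in> interior (dot_enlargement \<epsilon> B)"
      using assms by (rule subsetD[OF _ centre_in_ball[THEN iffD2]])
  qed
  moreover have "closure B \<subseteq> interior B \<union> frontier B"
    unfolding frontier_def by (rule subsetI) simp
  ultimately show ?thesis
    by (rule order_trans[OF _ Un_least, rotated])
qed

theorem theorem2p6:
  fixes h :: "real^'n \<Rightarrow> complex"
    and F :: "real^'n \<Rightarrow> 'x::complex_banach \<Rightarrow> 'y::complex_banach"
    and \<B> :: "'x set set"
    and \<epsilon> :: "'x set \<Rightarrow> real"
  assumes nonempty: "\<And>B. B \<in> \<B> \<Longrightarrow> B \<noteq> {}"
    and cover: "\<And>x. \<exists>B\<in>\<B>. x \<in> B"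
    and h_L1: "integrable lebesgue h"
    and F_cont: "continuous_on UNIV (\<lambda>(t, x). F t x)"
    and eps_pos: "\<And>B. B \<in> \<B> \<Longrightarrow> \<epsilon> B > 0"
    and F_bdd: "\<And>B. B \<in> \<B> \<Longrightarrow>
      bdd_above {norm (F t x) | t x. x \<in> dot_enlargement (\<epsilon> B) B}"
  shows "(\<forall>t x. strong_bochner_integrable lebesgue (\<lambda>\<sigma>. h \<sigma> *\<^sub>C F (t - \<sigma>) x)) \<and>
    (\<forall>B\<in>\<B>. bdd_above {norm (convolution h F t x) | t x. x \<in> dot_enlargement (\<epsilon> B) B}) \<and>
    (\<forall>\<omega> c. \<omega> \<noteq> 0 \<longrightarrow> c \<noteq> 0 \<longrightarrow> S_asymptotically_periodic \<B> \<omega> c F \<longrightarrow>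
       S_asymptotically_periodic \<B> \<omega> c (convolution h F)) \<and>
    (\<forall>\<omega> c. (\<forall>j. \<omega> j \<noteq> 0) \<longrightarrow> (\<forall>j. c j \<noteq> 0) \<longrightarrow>
       S_asymptotically_periodic_coordwise \<B> \<omega> c F \<longrightarrow>
       S_asymptotically_periodic_coordwise \<B> \<omega> c (convolution h F))"
proof -
  have "\<exists>K. \<forall>t x. x \<in> dot_enlargement (\<epsilon> B) B \<longrightarrow> norm (F t x) \<le> K" if "B \<in> \<B>" for B
    using F_bdd[OF that] unfolding bdd_above_def by blast
  then obtain K where K: "\<And>B t x. B \<in> \<B> \<Longrightarrow> x \<in> dot_enlargement (\<epsilon> B) B \<Longrightarrow> norm (F t x) \<le> K B"
    by metis
  have sub: "x \<in> interior (dot_enlargement (\<epsilon> B) B)" if "B \<in> \<B>" "x \<in> B" for B x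
    using closure_subset_interior_dot_enlargement[OF eps_pos[OF that(1)]] closure_subset that(2)
    by blast
  have F1: "continuous_on UNIV (\<lambda>t. F t x)" for x
  proof -
    have "continuous_on UNIV (\<lambda>t. case (t, x) of (t, x) \<Rightarrow> F t x)"
      by (intro continuous_on_compose2[OF F_cont] continuous_intros) simp
    then show ?thesis by simp
  qed
  \<comment> \<open>Since the family covers the space, each \<open>x\<close> inherits the bound of
    some \<open>B\<close> containing it.\<close>
  have int: "strong_bochner_integrable lebesgue (\<lambda>\<sigma>. h \<sigma> *\<^sub>C F (t - \<sigma>) x)" for t x
  proof -
    obtain B where "B \<in> \<B>" "x \<in> B" using cover by blast
    then have "norm (F s x) \<le> K B" for s
      using K sub interior_subset by blast
    then show ?thesis
      by (rule strong_bochner_integrable_convolution[where F = F and x = x, OF h_L1 F1])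
  qed
  have bdd: "bdd_above {norm (convolution h F t x) | t x. x \<in> dot_enlargement (\<epsilon> B) B}"
    if "B \<in> \<B>" for B
    by (rule bdd_aboveI) (use norm_convolution_le[where F = F, OF h_L1 F1 K[OF that]] in blast)
  \<comment> \<open>Joint continuity belongs to both notions of periodicity; on a metric domain it
    can be tested along sequences.\<close>
  have cont: "continuous_on UNIV (\<lambda>(t, x). convolution h F t x)"
    unfolding continuous_on_sequentially
  proof (intro allI ballI impI, elim conjE)
    fix p :: "(real^'n) \<times> 'x" and q assume q: "q \<longlonglongrightarrow> p"
    obtain t x where p: "p = (t, x)" by fastforce
    obtain B where B: "B \<in> \<B>" "x \<in> B" using cover by blast
    have "(\<lambda>n. convolution h F (fst (q n)) (snd (q n))) \<longlonglongrightarrow> convolution h F t x"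
    proof (rule convolution_tendsto[OF h_L1 F_cont open_interior sub[OF B]])
      show "norm (F t y) \<le> K B" if "y \<in> interior (dot_enlargement (\<epsilon> B) B)" for t y
        using K[OF B(1)] that interior_subset by blast
      show "(\<lambda>n. fst (q n)) \<longlonglongrightarrow> t" "(\<lambda>n. snd (q n)) \<longlonglongrightarrow> x"
        using tendsto_fst[OF q] tendsto_snd[OF q] p by simp_all
    qed
    then show "((\<lambda>(t, x). convolution h F t x) \<circ> q) \<longlonglongrightarrow> (case p of (t, x) \<Rightarrow> convolution h F t x)"
      by (simp add: p comp_def case_prod_unfold)
  qed
  \<comment> \<open>Keeping \<open>\<omega>\<close> and \<open>c\<close> arbitrary serves both
    claims: the coordinatewise one takes the shift \<open>\<omega> j *\<^sub>R axis j 1\<close> and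
    the factor \<open>c j\<close>.\<close>
  have lim: "uniform_limit B (\<lambda>t x. norm (convolution h F (t + \<omega>) x - c *\<^sub>C convolution h F t x))
      (\<lambda>_. 0) at_infinity"
    if "B \<in> \<B>" "uniform_limit B (\<lambda>t x. norm (F (t + \<omega>) x - c *\<^sub>C F t x)) (\<lambda>_. 0) at_infinity"
    for B \<omega> c
  proof (rule convolution_asymptotically_periodic[where F = F, OF h_L1 F1 _ that(2)])
    show "norm (F t x) \<le> K B" if "x \<in> B" for t x
      using K[OF \<open>B \<in> \<B>\<close>] sub[OF \<open>B \<in> \<B>\<close> that] interior_subset by blast
  qed
  show ?thesis
    unfolding S_asymptotically_periodic_def S_asymptotically_periodic_coordwise_def
    by (intro conjI allI impI ballI int bdd cont lim; blast)
qed

end
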